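(* Let $(T,d)$ be a metric space and $m$ a Borel probability measure on $T$ with $\operatorname{supp}(m)=T$. Let $a,b\ge 0$, $\varphi\in\mathcal{G}_{a,b}$ and $R\ge 2$. Put $A=\frac{R^3}{(R-1)(R-2)}$ and $B=\frac{R^2}{R-1}$. Then there exists a probability measure $\nu$ on $T\times T$ such that for all continuous functions $f:T\to\mathbb{R}$, $$\sup_{s,t\in T}|f(s)-f(t)|\le 2aA\,\mathcal{S}+2bB\,\bar{\mathcal{S}}\int_{T\times T}\varphi\left(\frac{|f(u)-f(v)|}{d(u,v)}\right)\nu(du,dv).$$
   Context: $B(x,\varepsilon)=\{y\in T:d(x,y)\le\varepsilon\}$ is the closed ball and $D(T)=\sup\{d(s,t):s,t\in T\}$ the diameter of $T$ (possibly $+\infty$). For $a,b\ge0$, $\mathcal{G}_{a,b}$ is the class of all functions $\varphi:\mathbb{R}_+\to\mathbb{R}$ that are (strictly) increasing and continuous, satisfy $\varphi(0)=0$, and satisfy $x\le a+b\frac{\varphi(xy)}{\varphi(y)}$ for all $x\ge 0$, $y\ge\varphi^{-1}(1)$; it is understood that the inverse $\varphi^{-1}$ is defined on $[0,\infty)$. Define $\sigma(x)=\int_0^{D(T)}\varphi^{-1}\left(\frac{1}{m(B(x,\varepsilon))}\right)d\varepsilon\in[0,\infty]$, $\bar{\mathcal{S}}=\int_T\sigma(u)\,m(du)\in[0,\infty]$ and $\mathcal{S}=\sup_{x\in T}\sigma(x)\in[0,\infty]$. Conventions: $0/0=0$ (in particular the integrand equals $\varphi(0)=0$ on the diagonal $u=v$);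 for $R=2$, $A=+\infty$; and $0\cdot\infty=0$. *)

theory Defs
  imports "HOL-Probability.Probability"
begin

text \<open>The metric space \<open>T\<close> is the universe of a type of class \<open>metric_space\<close>.\<close>

definition measure_support :: "'a::topological_space measure \<Rightarrow> 'a set" where
  "measure_support m = {x. \<forall>U. open U \<and> x \<in> U \<longrightarrow> emeasure m U > 0}"

definition inv_nonneg :: "(real \<Rightarrow> real) \<Rightarrow> real \<Rightarrow> real" where
  "inv_nonneg \<phi> = inv_into {0..} \<phi>"

text \<open>
  Only the values of \<open>\<phi>\<close> on \<open>{0..}\<close> matter. The condition \<open>\<phi> ` {0..} = {0..}\<close> expresses that
  the inverse of \<open>\<phi>\<close> is defined on all of \<open>{0..}\<close>.
\<close>

definition G_class :: "real \<Rightarrow> real \<Rightarrow> (real \<Rightarrow> real) set" where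
  "G_class a b = {\<phi>. strict_mono_on {0..} \<phi> \<and> continuous_on {0..} \<phi> \<and> \<phi> 0 = 0 \<and>
     \<phi> ` {0..} = {0..} \<and>
     (\<forall>x\<ge>0. \<forall>y\<ge>inv_nonneg \<phi> 1. x \<le> a + b * (\<phi> (x * y) / \<phi> y))}"

definition ediam :: "'a::metric_space set \<Rightarrow> ennreal" where
  "ediam X = (SUP s\<in>X. SUP t\<in>X. ennreal (dist s t))"

text \<open>
  The endpoint \<open>\<epsilon> = 0\<close> (a null set) is left out, since the ball of radius 0 may have measure 0.
\<close>

definition sigma_fun :: "(real \<Rightarrow> real) \<Rightarrow> 'a::metric_space measure \<Rightarrow> 'a \<Rightarrow> ennreal" where
  "sigma_fun \<phi> m x =
     (\<integral>\<^sup>+\<epsilon>\<in>{\<epsilon>. 0 < \<epsilon> \<and> ennreal \<epsilon> \<le> ediam (UNIV :: 'a set)}.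
        ennreal (inv_nonneg \<phi> (1 / measure m (cball x \<epsilon>))) \<partial>lborel)"

definition S_bar :: "(real \<Rightarrow> real) \<Rightarrow> 'a::metric_space measure \<Rightarrow> ennreal" where
  "S_bar \<phi> m = (\<integral>\<^sup>+u. sigma_fun \<phi> m u \<partial>m)"

definition S_sup :: "(real \<Rightarrow> real) \<Rightarrow> 'a::metric_space measure \<Rightarrow> ennreal" where
  "S_sup \<phi> m = (SUP x. sigma_fun \<phi> m x)"

definition A_const :: "real \<Rightarrow> ennreal" where
  "A_const R = (if R = 2 then \<infinity> else ennreal (R ^ 3 / ((R - 1) * (R - 2))))"

definition B_const :: "real \<Rightarrow> ennreal" where
  "B_const R = ennreal (R ^ 2 / (R - 1))"

end

theory Submission
  imports Defs
begin

text \<open>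
  Put \<open>y\<^sub>k = \<phi>\<^sup>-\<^sup>1(1) R\<^sup>k\<close>, let \<open>r\<^sub>k(x)\<close> be the least radius with
  \<open>m(B(x, r\<^sub>k(x))) \<ge> 1 / \<phi>(y\<^sub>k)\<close>, and let \<open>S\<^sub>k f(x)\<close> be the mean of \<open>f\<close> over that ball. Then
  \<open>S\<^sub>0 f = \<integral>f dm\<close> and \<open>S\<^sub>k f(t) \<rightarrow> f(t)\<close>. In
  \<open>S\<^sub>k\<^sub>+\<^sub>1 f - \<integral>f dm = S\<^sub>k\<^sub>+\<^sub>1 (f - S\<^sub>k f) + S\<^sub>k\<^sub>+\<^sub>1 (S\<^sub>k f - \<integral>f dm)\<close> the growth condition at \<open>y\<^sub>k\<^sub>+\<^sub>1\<close> bounds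
  \<open>\<bar>f(u) - f(v)\<bar>\<close>, \<open>d(u,v) \<le> r\<^sub>k(u)\<close>, by \<open>r\<^sub>k(u) y\<^sub>k\<^sub>+\<^sub>1 (a + b m(B) \<phi>(\<bar>f(u) - f(v)\<bar> / d(u,v)))\<close>, where
  \<open>B\<close> is the ball over which \<open>S\<^sub>k\<^sub>+\<^sub>1\<close> averages; the factor \<open>m(B)\<close> cancels the normalisation of that
  mean. As the \<open>r\<^sub>k\<close> are 1-Lipschitz, the terms with \<open>a\<close> add up to a multiple of
  \<open>\<Sum>\<^sub>k y\<^sub>k\<^sub>+\<^sub>1 r\<^sub>k(t) \<le> R\<^sup>2/(R - 1) \<sigma>(t)\<close>. The terms with \<open>b\<close> add up to the integral against
  \<open>\<Sum>\<^sub>k y\<^sub>k\<^sub>+\<^sub>1 r\<^sub>k(u) m(du) m(dv | B(u, r\<^sub>k(u)))\<close>, and \<open>\<nu>\<close> is this measure normalised. If the integral of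
  \<open>\<sigma>\<close> is infinite, \<open>\<nu> = m \<otimes> m\<close> works.
\<close>

section \<open>Measures of full support on metric spaces\<close>

lemma emeasure_open_pos:
  "measure_support m = UNIV \<Longrightarrow> open U \<Longrightarrow> x \<in> U \<Longrightarrow> 0 < emeasure m U"
  unfolding measure_support_def by blast

text \<open>The balls of radius e about the points of a \<open>separated e p\<close> set are
  disjoint and have mass at least p, so such a set has at most m(T)/p points and one of largest
  cardinality exists. Every x lies within 2e of it once the ball about x has mass at least p, and
  full support provides such a p > 0. Letting e and p run through the numbers 1/(n+1) gives a
  countable dense set.\<close>

lemma full_support_imp_separable:
  fixes m :: "'a::metric_space measure"
  assumes "finite_measure m" and sets_m: "sets m = sets borel" and supp: "measure_support m = UNIV"
  shows "\<exists>C :: 'a set. countable C \<and> (\<forall>x. \<forall>e>0. \<exists>c\<in>C. dist c x < e)"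
proof -
  interpret finite_measure m by fact
  define separated where "separated e p F \<longleftrightarrow> finite F \<and> (\<forall>x\<in>F. p \<le> measure m (ball x e)) \<and>
      (\<forall>x\<in>F. \<forall>y\<in>F. x \<noteq> y \<longrightarrow> 2 * e \<le> dist x y)" for e p :: real and F :: "'a set"
  have card_bound: "real (card F) * p \<le> measure m (space m)" if "separated e p F" for e p F
  proof -
    have disj: "disjoint_family_on (\<lambda>x. ball x e) F"
    proof (unfold disjoint_family_on_def, intro ballI impI)
      fix x y assume "x \<in> F" "y \<in> F" "x \<noteq> y"
      then have *: "2 * e \<le> dist x y" using that by (auto simp: separated_def)
      have "False" if "z \<in> ball x e \<inter> ball y e" for z
        using that * dist_triangle2[of x y z] by (auto simp: dist_commute)
      then show "ball x e \<inter> ball y e = {}" by blast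
    qed
    have "real (card F) * p = (\<Sum>x\<in>F. p)" by simp
    also have "\<dots> \<le> (\<Sum>x\<in>F. measure m (ball x e))"
      using that by (intro sum_mono) (auto simp: separated_def)
    also have "\<dots> = measure m (\<Union>x\<in>F. ball x e)"
      using that disj sets_m by (intro finite_measure_finite_Union[symmetric]) (auto simp: separated_def)
    also have "\<dots> \<le> measure m (space m)" by (rule bounded_measure)
    finally show ?thesis .
  qed
  have "\<exists>F. separated e p F \<and> (\<forall>G. separated e p G \<longrightarrow> card G \<le> card F)" if "p > 0" for e p
  proof -
    have "separated e p {}" by (auto simp: separated_def)
    moreover have "\<forall>G. separated e p G \<longrightarrow> card G < nat \<lceil>measure m (space m) / p\<rceil> + 1"
    proof (intro allI impI)
      fix G assume "separated e p G"
      from card_bound[OF this] that have "real (card G) \<le> measure m (space m) / p"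
        by (simp add: field_simps)
      then show "card G < nat \<lceil>measure m (space m) / p\<rceil> + 1" by linarith
    qed
    ultimately show ?thesis
      by (rule ex_has_greatest_nat)
  qed
  then have "\<forall>e p. \<exists>F. p > 0 \<longrightarrow> separated e p F \<and> (\<forall>G. separated e p G \<longrightarrow> card G \<le> card F)"
    by blast
  then obtain N where N: "\<And>e p. p > 0 \<Longrightarrow> separated e p (N e p)"
      and N_max: "\<And>e p G. p > 0 \<Longrightarrow> separated e p G \<Longrightarrow> card G \<le> card (N e p)"
    unfolding choice_iff by blast
  define C where "C = (\<Union>(i::nat) (j::nat). N (1 / Suc i) (1 / Suc j))"
  have "countable (N (1 / Suc i) (1 / Suc j))" for i j :: nat
    using N[of "1 / Suc j" "1 / Suc i"] by (simp add: separated_def countable_finite)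
  then have "countable C"
    unfolding C_def by (intro countable_UN countableI_type)
  moreover have "\<exists>c\<in>C. dist c x < e" if "e > 0" for x e
  proof -
    obtain i :: nat where i: "1 / Suc i < e / 2"
      using nat_approx_posE[of "e/2"] \<open>e > 0\<close> by auto
    have "emeasure m (ball x (1 / Suc i)) > 0"
      by (rule emeasure_open_pos[OF supp, of _ x]) auto
    then have "measure m (ball x (1 / Suc i)) > 0"
      by (simp add: emeasure_eq_measure)
    then obtain j :: nat where j: "1 / Suc j < measure m (ball x (1 / Suc i))"
      using nat_approx_posE by blast
    let ?N = "N (1 / Suc i) (1 / Suc j)"
    have sep: "separated (1 / Suc i) (1 / Suc j) ?N" by (intro N) simp
    \<comment> \<open>Otherwise x could be added to the separated set, against its maximal
      cardinality.\<close>
    have "\<exists>c\<in>?N. dist c x < 2 * (1 / Suc i)"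
    proof (rule ccontr)
      assume far: "\<not> ?thesis"
      then have "x \<notin> ?N" by force
      have "separated (1 / Suc i) (1 / Suc j) (insert x ?N)"
        using sep j far unfolding separated_def by (auto simp: not_less dist_commute)
      then have "card (insert x ?N) \<le> card ?N" by (intro N_max) simp_all
      then show False using \<open>x \<notin> ?N\<close> sep by (simp add: separated_def)
    qed
    then obtain c where c: "c \<in> ?N" "dist c x < 2 * (1 / Suc i)" by blast
    show ?thesis
    proof
      show "c \<in> C" using c(1) unfolding C_def by blast
      show "dist c x < e" using c(2) i by linarith
    qed
  qed
  ultimately show ?thesis by blast
qed

text \<open>The inclusion that uses separability: an open subset of the product is the union of the
  products of balls that it contains, where centres from C and radii 1/(n+1) suffice, and these are
  countably many.\<close>

lemma sets_borel_prod_separable: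
  fixes C :: "'a::metric_space set"
  assumes C: "countable C" and dense: "\<And>x e. e > 0 \<Longrightarrow> \<exists>c\<in>C. dist c x < e"
  shows "sets (borel \<Otimes>\<^sub>M borel) = sets (borel :: ('a \<times> 'a) measure)"
proof
  show "sets (borel \<Otimes>\<^sub>M borel) \<subseteq> sets (borel :: ('a \<times> 'a) measure)"
  proof (rule sets_pair_in_sets)
    fix A B :: "'a set" assume [measurable]: "A \<in> sets borel" "B \<in> sets borel"
    have "fst \<in> borel_measurable (borel :: ('a \<times> 'a) measure)"
      "snd \<in> borel_measurable (borel :: ('a \<times> 'a) measure)"
      by (auto intro!: borel_measurable_continuous_onI continuous_intros)
    then have "fst -` A \<inter> snd -` B \<in> sets (borel :: ('a \<times> 'a) measure)"
      by (metis \<open>A \<in> sets borel\<close> \<open>B \<in> sets borel\<close> measurable_sets_borel sets.Int)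
    also have "fst -` A \<inter> snd -` B = A \<times> B" by auto
    finally show "A \<times> B \<in> sets borel" .
  qed
  have "sets (borel :: ('a \<times> 'a) measure) = sigma_sets UNIV {S. open S}"
    by (simp add: borel_def)
  also have "\<dots> \<subseteq> sets (borel \<Otimes>\<^sub>M borel)"
  proof (rule sets.sigma_sets_subset')
    show "UNIV \<in> sets (borel \<Otimes>\<^sub>M borel :: ('a \<times> 'a) measure)"
      using sets.top[of "borel \<Otimes>\<^sub>M borel :: ('a \<times> 'a) measure"] by (simp add: space_pair_measure)
    show "{S. open S} \<subseteq> sets (borel \<Otimes>\<^sub>M borel :: ('a \<times> 'a) measure)"
    proof safe
      fix S :: "('a \<times> 'a) set" assume "open S"
      define I where "I = {(c, d, n). c \<in> C \<and> d \<in> C \<and> ball c (1 / Suc n) \<times> ball d (1 / Suc n) \<subseteq> S}"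
      have "I \<subseteq> C \<times> C \<times> UNIV" by (auto simp: I_def)
      then have "countable I" by (rule countable_subset) (use C in auto)
      have "S = (\<Union>(c, d, n)\<in>I. ball c (1 / Suc n) \<times> ball d (1 / Suc n))"
      proof (intro equalityI subsetI)
        fix z assume "z \<in> S"
        obtain x y where z: "z = (x, y)" by force
        obtain U V where UV: "open U" "open V" "x \<in> U" "y \<in> V" "U \<times> V \<subseteq> S"
          using open_prod_elim[OF \<open>open S\<close> \<open>z \<in> S\<close>] unfolding z by (metis mem_Sigma_iff)
        obtain e1 where e1: "e1 > 0" "ball x e1 \<subseteq> U" using UV by (meson openE)
        obtain e2 where e2: "e2 > 0" "ball y e2 \<subseteq> V" using UV by (meson openE)
        obtain n :: nat where n: "1 / Suc n < min e1 e2 / 2"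
          using nat_approx_posE[of "min e1 e2 / 2"] e1 e2 by auto
        obtain c where c: "c \<in> C" "dist c x < 1 / Suc n" using dense[of "1 / Suc n" x] by auto
        obtain d where d: "d \<in> C" "dist d y < 1 / Suc n" using dense[of "1 / Suc n" y] by auto
        have "ball c (1 / Suc n) \<subseteq> ball x e1"
        proof
          fix w assume "w \<in> ball c (1 / Suc n)"
          then show "w \<in> ball x e1" using c n dist_triangle[of x w c] by (simp add: dist_commute)
        qed
        moreover have "ball d (1 / Suc n) \<subseteq> ball y e2"
        proof
          fix w assume "w \<in> ball d (1 / Suc n)"
          then show "w \<in> ball y e2" using d n dist_triangle[of y w d] by (simp add: dist_commute)
        qed
        ultimately have "ball c (1 / Suc n) \<times> ball d (1 / Suc n) \<subseteq> S"
          using e1 e2 UV by blast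
        then have "(c, d, n) \<in> I" using c d by (simp add: I_def)
        moreover have "z \<in> ball c (1 / Suc n) \<times> ball d (1 / Suc n)" using c d z by simp
        ultimately show "z \<in> (\<Union>(c, d, n)\<in>I. ball c (1 / Suc n) \<times> ball d (1 / Suc n))" by blast
      qed (auto simp: I_def)
      also have "\<dots> \<in> sets (borel \<Otimes>\<^sub>M borel)"
        using \<open>countable I\<close> by (intro sets.countable_UN') auto
      finally show "S \<in> sets (borel \<Otimes>\<^sub>M borel)" .
    qed
  qed
  finally show "sets (borel :: ('a \<times> 'a) measure) \<subseteq> sets (borel \<Otimes>\<^sub>M borel)" .
qed

text \<open>This makes measures with a density against \<open>m \<Otimes>\<^sub>M m\<close> Borel
  measures on the product, and continuous functions of two variables measurable for it.\<close>

lemma sets_pair_measure_full_support: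
  fixes m :: "'a::metric_space measure"
  assumes "finite_measure m" and "sets m = sets borel" and "measure_support m = UNIV"
  shows "sets (m \<Otimes>\<^sub>M m) = sets borel"
proof -
  obtain C :: "'a set" where "countable C" "\<And>x e. e > 0 \<Longrightarrow> \<exists>c\<in>C. dist c x < e"
    using full_support_imp_separable[OF assms] by blast
  then have "sets (borel \<Otimes>\<^sub>M borel) = sets (borel :: ('a \<times> 'a) measure)"
    by (rule sets_borel_prod_separable)
  then show ?thesis using assms(2) by simp
qed

section \<open>Functions of class \<open>G\<close>\<close>

lemma
  assumes "\<phi> \<in> G_class a b"
  shows G_class_zero: "\<phi> 0 = 0"
    and G_class_strict_mono: "0 \<le> x \<Longrightarrow> x < y \<Longrightarrow> \<phi> x < \<phi> y"
    and G_class_mono: "0 \<le> x \<Longrightarrow> x \<le> y \<Longrightarrow> \<phi> x \<le> \<phi> y"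
    and G_class_nonneg: "0 \<le> x \<Longrightarrow> 0 \<le> \<phi> x"
    and G_class_inv: "0 \<le> z \<Longrightarrow> \<phi> (inv_nonneg \<phi> z) = z"
    and G_class_inv_nonneg: "0 \<le> z \<Longrightarrow> 0 \<le> inv_nonneg \<phi> z"
    and G_class_growth: "0 \<le> x \<Longrightarrow> inv_nonneg \<phi> 1 \<le> y \<Longrightarrow> x \<le> a + b * (\<phi> (x * y) / \<phi> y)"
    and G_class_measurable: "(\<lambda>x. \<phi> (max 0 x)) \<in> borel_measurable borel"
proof -
  have sm: "strict_mono_on {0..} \<phi>" and z: "\<phi> 0 = 0" and im: "\<phi> ` {0..} = {0..}"
    and co: "continuous_on {0..} \<phi>"
    using assms by (auto simp: G_class_def)
  show "\<phi> 0 = 0" by fact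
  show smono: "\<phi> x < \<phi> y" if "0 \<le> x" "x < y" for x y
    using sm that by (auto simp: strict_mono_on_def)
  show mono: "\<phi> x \<le> \<phi> y" if "0 \<le> x" "x \<le> y" for x y
    using smono[of x y] that by (cases "x = y") auto
  show "0 \<le> \<phi> x" if "0 \<le> x" for x using mono[of 0 x] that z by simp
  show "\<phi> (inv_nonneg \<phi> z) = z" if "0 \<le> z" for z
    unfolding inv_nonneg_def using im that by (intro f_inv_into_f) auto
  show "0 \<le> inv_nonneg \<phi> z" if "0 \<le> z" for z
    using inv_into_into[of z \<phi> "{0..}"] im that unfolding inv_nonneg_def by auto
  show "x \<le> a + b * (\<phi> (x * y) / \<phi> y)" if "0 \<le> x" "inv_nonneg \<phi> 1 \<le> y" for x y
    using assms that by (auto simp: G_class_def)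
  \<comment> \<open>Nothing is known about \<phi> at negative arguments; composing with
    \<open>max 0\<close> extends it continuously from the half-line.\<close>
  have "continuous_on UNIV (\<lambda>x. \<phi> (max 0 x))"
    by (rule continuous_on_compose2[OF co]) (auto intro!: continuous_intros)
  then show "(\<lambda>x. \<phi> (max 0 x)) \<in> borel_measurable borel"
    by (rule borel_measurable_continuous_onI)
qed

lemma G_class_less_inv:
  assumes "\<phi> \<in> G_class a b" "0 \<le> y" "0 \<le> z" "\<phi> y < z"
  shows "y < inv_nonneg \<phi> z"
proof (rule ccontr)
  assume "\<not> ?thesis"
  then have "\<phi> (inv_nonneg \<phi> z) \<le> \<phi> y"
    using assms by (intro G_class_mono[OF assms(1)] G_class_inv_nonneg[OF assms(1)]) auto
  then show False using assms by (simp add: G_class_inv[OF assms(1)])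
qed

lemma G_class_inv_one_pos:
  assumes "\<phi> \<in> G_class a b"
  shows "0 < inv_nonneg \<phi> 1"
  using G_class_less_inv[OF assms, of 0 1] G_class_zero[OF assms] by simp

text \<open>For b = 0 the growth condition would bound every x \<ge> 0 by a. Positivity of b keeps
  the last term of the theorem infinite, and not 0 times infinity, when \<open>S_bar\<close> is
  infinite and the integral is nonzero.\<close>

lemma G_class_b_pos:
  assumes G: "\<phi> \<in> G_class a b" and "0 \<le> b"
  shows "0 < b"
proof (rule ccontr)
  assume "\<not> 0 < b"
  then have "b = 0" using assms by simp
  then have "\<bar>a\<bar> + 1 \<le> a"
    using G_class_growth[OF G, of "\<bar>a\<bar> + 1" "inv_nonneg \<phi> 1"] by simp
  then show False by simp
qed

section \<open>The standing assumptions and the geometric scale of levels\<close>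

locale full_support_prob = prob_space m for m :: "'a::metric_space measure" +
  fixes a b R :: real and \<phi> :: "real \<Rightarrow> real"
  assumes sets_m: "sets m = sets borel"
    and support: "measure_support m = UNIV"
    and G: "\<phi> \<in> G_class a b"
    and a_nonneg: "0 \<le> a" and b_nonneg: "0 \<le> b"
    and R_ge: "2 \<le> R"
begin

lemma space_m: "space m = UNIV"
  using sets_eq_imp_space_eq[OF sets_m] by simp

lemma cball_sets [measurable, simp]: "cball x e \<in> sets m"
  by (simp add: sets_m)

lemma measure_cball_pos: "0 < e \<Longrightarrow> 0 < measure m (cball x e)"
proof -
  assume "0 < e"
  then have "0 < emeasure m (ball x e)"
    by (intro emeasure_open_pos[OF support, of _ x]) auto
  also have "\<dots> \<le> emeasure m (cball x e)" by (intro emeasure_mono) auto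
  finally show ?thesis by (simp add: emeasure_eq_measure)
qed

text \<open>The scale starts at the least argument for which the growth condition is available.
  There \<phi> equals 1, so a ball of level 0 must carry the full mass.\<close>

definition level :: "nat \<Rightarrow> real" where
  "level k = inv_nonneg \<phi> 1 * R ^ k"

lemma level_pos: "0 < level k"
  using G_class_inv_one_pos[OF G] R_ge by (simp add: level_def)

lemma level_Suc: "level (Suc k) = R * level k"
  by (simp add: level_def)

lemma level_ge: "inv_nonneg \<phi> 1 \<le> level k"
  using G_class_inv_one_pos[OF G] R_ge by (simp add: level_def)

lemma phi_level_ge_1: "1 \<le> \<phi> (level k)"
  using G_class_mono[OF G _ level_ge, of k] G_class_inv[OF G, of 1] G_class_inv_one_pos[OF G] by simp

lemma phi_level_0: "\<phi> (level 0) = 1"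
  using G_class_inv[OF G, of 1] by (simp add: level_def)

text \<open>Division by zero yields 0, so this is \<phi> 0 = 0 on the diagonal, in accordance with
  the convention 0/0 = 0.\<close>

definition quot :: "('a \<Rightarrow> real) \<Rightarrow> 'a \<times> 'a \<Rightarrow> ennreal" where
  "quot f = (\<lambda>(u, v). ennreal (\<phi> (\<bar>f u - f v\<bar> / dist u v)))"

lemma sets_pair: "sets (m \<Otimes>\<^sub>M m) = sets borel"
  by (rule sets_pair_measure_full_support[OF finite_measure_axioms sets_m support])

lemma measurable_pair_continuous:
  fixes g :: "'a \<times> 'a \<Rightarrow> 'b::topological_space"
  shows "continuous_on UNIV g \<Longrightarrow> g \<in> borel_measurable (m \<Otimes>\<^sub>M m)"
  using borel_measurable_continuous_onI[of g] by (simp cong: measurable_cong_sets[OF sets_pair refl])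

lemma measurable_continuous: "continuous_on UNIV g \<Longrightarrow> g \<in> borel_measurable m"
  for g :: "'a \<Rightarrow> 'b::topological_space"
  using borel_measurable_continuous_onI[of g] by (simp cong: measurable_cong_sets[OF sets_m refl])

lemma quot_measurable [measurable]:
  assumes "continuous_on UNIV f"
  shows "quot f \<in> borel_measurable (m \<Otimes>\<^sub>M m)"
proof -
  have "(\<lambda>z. \<bar>f (fst z) - f (snd z)\<bar>) \<in> borel_measurable (m \<Otimes>\<^sub>M m)"
    by (intro measurable_pair_continuous continuous_intros continuous_on_compose2[OF assms]) auto
  moreover have "(\<lambda>z. dist (fst z) (snd z)) \<in> borel_measurable (m \<Otimes>\<^sub>M m)"
    by (intro measurable_pair_continuous continuous_intros)
  ultimately have "(\<lambda>z. \<bar>f (fst z) - f (snd z)\<bar> / dist (fst z) (snd z)) \<in> borel_measurable (m \<Otimes>\<^sub>M m)"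
    by measurable
  from measurable_compose[OF this G_class_measurable[OF G]]
  have "(\<lambda>z. ennreal (\<phi> (max 0 (\<bar>f (fst z) - f (snd z)\<bar> / dist (fst z) (snd z))))) \<in> borel_measurable (m \<Otimes>\<^sub>M m)"
    by measurable
  then show ?thesis by (simp add: quot_def case_prod_beta max_def)
qed

end

section \<open>Radii at which balls reach a prescribed mass, in a bounded space\<close>

locale majorizing_measure = full_support_prob m a b R \<phi>
  for m :: "'a::metric_space measure" and a b R :: real and \<phi> :: "real \<Rightarrow> real" +
  fixes D :: real
  assumes dist_le_D: "dist (x :: 'a) y \<le> D"
begin

text \<open>The infimum is over a nonempty set: the bound D on all distances is admissible at every
  level (\<open>D_admissible\<close>).\<close>

definition radius :: "nat \<Rightarrow> 'a \<Rightarrow> real" where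
  "radius k x = Inf {e. 0 \<le> e \<and> 1 \<le> \<phi> (level k) * measure m (cball x e)}"

lemma radius_le: "0 \<le> e \<Longrightarrow> 1 \<le> \<phi> (level k) * measure m (cball x e) \<Longrightarrow> radius k x \<le> e"
  unfolding radius_def by (rule cInf_lower) (auto intro!: bdd_belowI[of _ 0])

lemma D_nonneg: "0 \<le> D"
  using dist_le_D[of undefined undefined] by simp

lemma D_admissible: "1 \<le> \<phi> (level k) * measure m (cball x D)"
proof -
  have "cball x D = space m" using dist_le_D by (auto simp: space_m)
  then show ?thesis using phi_level_ge_1 by (simp add: prob_space)
qed

lemma radius_greatest:
  "(\<And>e. 0 \<le> e \<Longrightarrow> 1 \<le> \<phi> (level k) * measure m (cball x e) \<Longrightarrow> z \<le> e) \<Longrightarrow> z \<le> radius k x"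
  unfolding radius_def using D_nonneg D_admissible by (intro cInf_greatest) auto

lemma radius_nonneg: "0 \<le> radius k x"
  by (rule radius_greatest)

text \<open>Closed balls of radius r + 1/(n+1) decrease to the closed ball of radius r, so
  continuity of m from above applies. In particular the ball has positive mass even if its radius is
  0.\<close>

lemma radius_attained: "1 \<le> \<phi> (level k) * measure m (cball x (radius k x))"
proof -
  define A where "A n = cball x (radius k x + 1 / Suc n)" for n
  have ge: "1 \<le> \<phi> (level k) * measure m (A n)" for n
  proof -
    have "\<exists>e. 0 \<le> e \<and> 1 \<le> \<phi> (level k) * measure m (cball x e) \<and> e < radius k x + 1 / Suc n"
    proof (rule ccontr)
      assume "\<not> ?thesis"
      then have "radius k x + 1 / Suc n \<le> radius k x" by (intro radius_greatest) force
      then show False by simp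
    qed
    then obtain e where e: "1 \<le> \<phi> (level k) * measure m (cball x e)" "e < radius k x + 1 / Suc n"
      by blast
    have "measure m (cball x e) \<le> measure m (A n)"
      unfolding A_def using e by (intro finite_measure_mono) auto
    then have "\<phi> (level k) * measure m (cball x e) \<le> \<phi> (level k) * measure m (A n)"
      using phi_level_ge_1[of k] by (intro mult_left_mono) auto
    then show ?thesis using e by simp
  qed
  have "decseq A"
    unfolding A_def by (intro decseq_SucI subset_cball) (simp add: field_simps)
  then have "(\<lambda>n. measure m (A n)) \<longlonglongrightarrow> measure m (\<Inter>n. A n)"
    by (rule finite_Lim_measure_decseq[rotated]) (auto simp: A_def)
  also have "(\<Inter>n. A n) = cball x (radius k x)"
  proof (intro equalityI subsetI)
    fix z assume z: "z \<in> (\<Inter>n. A n)"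
    have "dist x z \<le> radius k x"
    proof (rule field_le_epsilon)
      fix e :: real assume "0 < e"
      then obtain n :: nat where "1 / Suc n < e" using nat_approx_posE by blast
      moreover have "z \<in> A n" using z by blast
      ultimately show "dist x z \<le> radius k x + e" by (simp add: A_def)
    qed
    then show "z \<in> cball x (radius k x)" by simp
  qed (auto simp: A_def intro: add_increasing2)
  finally have "(\<lambda>n. \<phi> (level k) * measure m (A n)) \<longlonglongrightarrow> \<phi> (level k) * measure m (cball x (radius k x))"
    by (intro tendsto_intros)
  then show ?thesis by (rule LIMSEQ_le_const) (use ge in auto)
qed

lemma measure_radius_pos: "0 < measure m (cball x (radius k x))"
  using radius_attained[of k x] by (smt (verit) measure_nonneg mult_eq_0_iff)

lemma emeasure_radius_pos: "emeasure m (cball x (radius k x)) \<noteq> 0"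
  using measure_radius_pos[of x k] by (simp add: emeasure_eq_measure)

text \<open>Enlarging the radius at y by the distance to x gives a ball about x that contains the
  one about y, hence has enough mass.\<close>

lemma radius_lipschitz: "radius k x \<le> radius k y + dist x y"
proof (rule radius_le)
  have "cball y (radius k y) \<subseteq> cball x (radius k y + dist x y)"
  proof
    fix z assume "z \<in> cball y (radius k y)"
    then show "z \<in> cball x (radius k y + dist x y)" using dist_triangle[of x z y] by simp
  qed
  then have "measure m (cball y (radius k y)) \<le> measure m (cball x (radius k y + dist x y))"
    by (intro finite_measure_mono) auto
  then have "\<phi> (level k) * measure m (cball y (radius k y))
      \<le> \<phi> (level k) * measure m (cball x (radius k y + dist x y))"
    using phi_level_ge_1[of k] by (intro mult_left_mono) auto
  then show "1 \<le> \<phi> (level k) * measure m (cball x (radius k y + dist x y))"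
    using radius_attained[of k y] by simp
qed (simp add: radius_nonneg)

lemma continuous_radius: "continuous_on UNIV (radius k)"
proof -
  have "dist (radius k x) (radius k y) \<le> dist x y" for x y
    using radius_lipschitz[of k x y] radius_lipschitz[of k y x]
    by (simp add: dist_real_def dist_commute abs_le_iff)
  then show ?thesis
    unfolding continuous_on_iff by (meson le_less_trans)
qed

text \<open>By full support \<open>cball x e\<close> has a mass p > 0, and since the levels tend to
  infinity, \<phi> eventually exceeds 1/p along them. This is what lets the local means of a
  continuous function converge to its value.\<close>

lemma radius_arbitrarily_small:
  assumes "0 < e"
  shows "\<exists>n. radius n x \<le> e"
proof -
  define p where "p = measure m (cball x e)"
  have p: "0 < p" using measure_cball_pos[OF assms] by (simp add: p_def)
  obtain n where n: "inv_nonneg \<phi> (1 / p) / inv_nonneg \<phi> 1 < R ^ n"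
    using real_arch_pow[of R] R_ge by auto
  then have "inv_nonneg \<phi> (1 / p) \<le> level n"
    using G_class_inv_one_pos[OF G] by (simp add: level_def field_simps)
  then have "1 / p \<le> \<phi> (level n)"
    using G_class_mono[OF G G_class_inv_nonneg[OF G], of "1 / p"] G_class_inv[OF G, of "1/p"] p by simp
  then have "radius n x \<le> e"
    using p assms by (intro radius_le) (auto simp: p_def field_simps)
  then show ?thesis ..
qed

section \<open>Comparison with the majorizing integral\<close>

text \<open>By minimality of the radius, a smaller ball has mass below
  1/\<phi>(\<open>level k\<close>); inverting \<phi> gives the claim.\<close>

lemma level_less_integrand:
  assumes "0 < e" "e < radius k x"
  shows "level k < inv_nonneg \<phi> (1 / measure m (cball x e))"
proof -
  have p: "0 < measure m (cball x e)" by (rule measure_cball_pos[OF assms(1)])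
  have "\<phi> (level k) * measure m (cball x e) < 1"
    using radius_le[of e k x] assms by force
  then show ?thesis
    using p level_pos[of k] by (intro G_class_less_inv[OF G]) (auto simp: field_simps)
qed

text \<open>The levels grow geometrically with ratio R, so a sum of distinct levels is at most R/(R
  - 1) times the largest of them.\<close>

lemma sum_level_le:
  assumes "finite K" "0 \<le> h" "\<And>k. k \<in> K \<Longrightarrow> level k \<le> h"
  shows "(R - 1) / R * (\<Sum>k\<in>K. level k) \<le> h"
proof (cases "K = {}")
  case False
  define n where "n = Max K"
  have "(\<Sum>k\<in>K. level k) \<le> (\<Sum>k\<le>n. level k)"
    using assms(1) level_pos by (intro sum_mono2) (auto simp: n_def less_imp_le)
  moreover have "(R - 1) * (\<Sum>k\<le>n. level k) = R * level n - level 0" for n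
    by (induction n) (auto simp: level_Suc algebra_simps level_def)
  ultimately have "(R - 1) * (\<Sum>k\<in>K. level k) \<le> R * level n"
    using R_ge level_pos[of 0]
    by (smt (verit, best) mult_left_mono)
  then have "(R - 1) / R * (\<Sum>k\<in>K. level k) \<le> level n"
    using R_ge by (simp add: field_simps)
  also have "\<dots> \<le> h" using assms False by (simp add: n_def)
  finally show ?thesis .
qed (use assms in simp)

text \<open>Each product of level and radius is the integral of a constant over (0,
  \<open>radius k x\<close>). After sum and integral are exchanged, the levels that contribute at e
  all lie below the integrand of \<sigma> at e, and their sum is controlled by
  \<open>sum_level_le\<close>.\<close>

lemma sum_radius_le_sigma:
  "ennreal ((R - 1) / R\<^sup>2 * (\<Sum>k<n. level (Suc k) * radius k x)) \<le> sigma_fun \<phi> m x"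
proof -
  define I where "I k = {0<..<radius k x}" for k
  \<comment> \<open>Points below the radius lie in the domain of integration of \<sigma>: beyond the
    diameter the ball is the whole space, so its radius would already be admissible.\<close>
  have ediam: "ennreal e \<le> ediam (UNIV :: 'a set)" if "0 < e" "e < radius k x" for e k
  proof (rule ccontr)
    assume less: "\<not> ?thesis"
    have "dist u v \<le> e" for u v :: 'a
    proof -
      have "ennreal (dist u v) \<le> ediam (UNIV :: 'a set)"
        unfolding ediam_def by (intro SUP_upper2[of u] SUP_upper2[of v]) auto
      then have "ennreal (dist u v) \<le> ennreal e" using less by simp
      then show ?thesis using that by (simp add: ennreal_le_iff)
    qed
    then have "cball x e = space m" by (auto simp: space_m)
    then have "radius k x \<le> e"
      using phi_level_ge_1 that by (intro radius_le) (auto simp: prob_space)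
    then show False using that by simp
  qed
  \<comment> \<open>One factor R pays for passing from \<open>level (Suc k)\<close> to
    \<open>level k\<close>, the other enters the geometric sum.\<close>
  have "(R - 1) / R\<^sup>2 * (\<Sum>k<n. level (Suc k) * radius k x)
      = (\<Sum>k<n. (R - 1) / R * level k * radius k x)"
    unfolding sum_distrib_left
    using R_ge by (intro sum.cong) (auto simp: level_Suc power2_eq_square field_simps)
  then have "ennreal ((R - 1) / R\<^sup>2 * (\<Sum>k<n. level (Suc k) * radius k x))
      = (\<Sum>k<n. ennreal ((R - 1) / R * level k * radius k x))"
    using R_ge level_pos radius_nonneg
    by (simp add: sum_ennreal less_imp_le)
  also have "\<dots> = (\<Sum>k<n. \<integral>\<^sup>+e. ennreal ((R - 1) / R * level k) * indicator (I k) e \<partial>lborel)"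
    using R_ge level_pos radius_nonneg
    by (intro sum.cong refl)
      (simp add: nn_integral_cmult_indicator I_def less_imp_le flip: ennreal_mult'')
  also have "\<dots> = (\<integral>\<^sup>+e. (\<Sum>k<n. ennreal ((R - 1) / R * level k) * indicator (I k) e) \<partial>lborel)"
    by (subst nn_integral_sum) (auto simp: I_def)
  also have "\<dots> \<le> sigma_fun \<phi> m x"
    unfolding sigma_fun_def
  proof (rule nn_integral_mono)
    fix e :: real
    define K where "K = {k. k < n \<and> e \<in> I k}"
    let ?h = "inv_nonneg \<phi> (1 / measure m (cball x e))"
    have "(\<Sum>k<n. ennreal ((R - 1) / R * level k) * indicator (I k) e)
        = (\<Sum>k\<in>K. ennreal ((R - 1) / R * level k))"
      unfolding K_def by (intro sum.mono_neutral_cong_right) auto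
    also have "\<dots> = ennreal ((R - 1) / R * (\<Sum>k\<in>K. level k))"
      using R_ge level_pos by (simp add: sum_ennreal sum_distrib_left less_imp_le)
    also have "\<dots> \<le> ennreal ?h * indicator {e. 0 < e \<and> ennreal e \<le> ediam (UNIV :: 'a set)} e"
    proof (cases "K = {}")
      case False
      then have "0 < e" "ennreal e \<le> ediam (UNIV :: 'a set)"
        using ediam by (auto simp: K_def I_def)
      moreover have "(R - 1) / R * (\<Sum>k\<in>K. level k) \<le> ?h"
        using level_less_integrand \<open>0 < e\<close>
        by (intro sum_level_le) (auto simp: K_def I_def less_imp_le intro!: G_class_inv_nonneg[OF G])
      ultimately show ?thesis by (simp add: ennreal_leI)
    qed simp
    finally show "(\<Sum>k<n. ennreal ((R - 1) / R * level k) * indicator (I k) e)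
        \<le> ennreal ?h * indicator {e. 0 < e \<and> ennreal e \<le> ediam (UNIV :: 'a set)} e" .
  qed
  finally show ?thesis .
qed

section \<open>Chaining by local means\<close>

abbreviation local_unif :: "nat \<Rightarrow> 'a \<Rightarrow> 'a measure" where
  "local_unif k x \<equiv> uniform_measure m (cball x (radius k x))"

definition mean :: "nat \<Rightarrow> ('a \<Rightarrow> real) \<Rightarrow> 'a \<Rightarrow> real" where
  "mean k f x = (\<integral>v. f v \<partial>local_unif k x)"

text \<open>The weight pairs the radius of step k with the level at which the growth condition is
  used for the passage to step k + 1.\<close>

definition energy :: "nat \<Rightarrow> ('a \<Rightarrow> real) \<Rightarrow> ennreal" where
  "energy k f = (\<integral>\<^sup>+u. ennreal (level (Suc k) * radius k u) *
     (\<integral>\<^sup>+v. quot f (u, v) \<partial>local_unif k u) \<partial>m)"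

lemma prob_space_local_unif: "prob_space (local_unif k x)"
  by (rule prob_space_uniform_measure[OF emeasure_radius_pos]) simp

text \<open>Since \<phi>(\<open>level 0\<close>) = 1, the ball has mass 1 and conditioning on it
  changes nothing. The chain of means therefore starts at the expectation, whatever the
  point.\<close>

lemma local_unif_0: "local_unif 0 x = m"
proof (rule measure_eqI)
  fix A assume "A \<in> sets (local_unif 0 x)"
  then have [measurable]: "A \<in> sets m" by simp
  have "measure m (cball x (radius 0 x)) = 1"
    using radius_attained[of 0 x] prob_le_1[of "cball x (radius 0 x)"] by (simp add: phi_level_0)
  moreover from this have "AE z in m. z \<in> cball x (radius 0 x)"
    by (subst AE_in_set_eq_1) simp_all
  then have "emeasure m (cball x (radius 0 x) \<inter> A) = emeasure m A"
    by (intro emeasure_eq_AE) auto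
  ultimately show "emeasure (local_unif 0 x) A = emeasure m A"
    by (simp add: emeasure_eq_measure[of "cball x (radius 0 x)"] divide_ennreal_def)
qed simp

lemma radius_measurable [measurable]: "radius k \<in> borel_measurable m"
  by (rule measurable_continuous[OF continuous_radius])

text \<open>Continuity of the radius makes the set closed. The measurability in u of masses of, and
  means over, the balls about u rests on this.\<close>

lemma measurable_in_ball:
  "{z. dist (fst z) (snd z) \<le> radius k (fst z)} \<in> sets (m \<Otimes>\<^sub>M m)"
proof -
  have "continuous_on UNIV (\<lambda>z::'a \<times> 'a. radius k (fst z))"
    by (rule continuous_on_compose2[OF continuous_radius]) (auto intro!: continuous_intros)
  then have "closed {z :: 'a \<times> 'a. dist (fst z) (snd z) \<le> radius k (fst z)}"
    by (intro closed_Collect_le continuous_intros)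
  then show ?thesis by (simp add: sets_pair)
qed

lemma indicator_in_ball_measurable [measurable]:
  "(\<lambda>(u, v). indicator (cball u (radius k u)) v :: ennreal) \<in> borel_measurable (m \<Otimes>\<^sub>M m)"
proof -
  have "indicator {z. dist (fst z) (snd z) \<le> radius k (fst z)} \<in> borel_measurable (m \<Otimes>\<^sub>M m)"
    by (rule borel_measurable_indicator[OF measurable_in_ball])
  also have "indicator {z. dist (fst z) (snd z) \<le> radius k (fst z)} =
      (\<lambda>(u, v). indicator (cball u (radius k u)) v :: ennreal)"
    by (auto simp: fun_eq_iff indicator_def)
  finally show ?thesis .
qed

lemma emeasure_ball_measurable [measurable]:
  "(\<lambda>u. emeasure m (cball u (radius k u))) \<in> borel_measurable m"
proof -
  have "(\<lambda>u. \<integral>\<^sup>+v. indicator (cball u (radius k u)) v \<partial>m) \<in> borel_measurable m"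
    by (rule borel_measurable_nn_integral) measurable
  then show ?thesis by simp
qed

lemma measurable_section:
  assumes "g \<in> borel_measurable (m \<Otimes>\<^sub>M m)"
  shows "(\<lambda>v. g (u, v)) \<in> borel_measurable m"
  using measurable_compose[OF measurable_Pair1' assms] by (simp add: space_m)

lemma nn_integral_local_unif:
  fixes g :: "'a \<Rightarrow> ennreal"
  assumes "g \<in> borel_measurable m"
  shows "(\<integral>\<^sup>+v. g v \<partial>local_unif k x) =
    (\<integral>\<^sup>+v. g v * indicator (cball x (radius k x)) v \<partial>m) / emeasure m (cball x (radius k x))"
  using assms by (rule nn_integral_uniform_measure) simp

text \<open>The measure of integration varies with u; written as an integral against m with an
  indicator, divided by the mass of the ball, the expression falls under Tonelli's theorem.\<close>

lemma local_integral_measurable: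
  fixes g :: "'a \<times> 'a \<Rightarrow> ennreal"
  assumes g[measurable]: "g \<in> borel_measurable (m \<Otimes>\<^sub>M m)"
  shows "(\<lambda>u. \<integral>\<^sup>+v. g (u, v) \<partial>local_unif k u) \<in> borel_measurable m"
  unfolding nn_integral_local_unif[OF measurable_section[OF g]] by measurable

lemma AE_local_unif: "(\<And>v. dist x v \<le> radius k x \<Longrightarrow> P v) \<Longrightarrow> AE v in local_unif k x. P v"
  by (rule AE_uniform_measureI) auto

text \<open>Boundedness makes f integrable, so that c can be moved under the integral; the rest is
  the triangle inequality for integrals.\<close>

lemma mean_deviation:
  fixes f :: "'a \<Rightarrow> real"
  assumes f: "continuous_on UNIV f" and bd: "\<And>x. \<bar>f x\<bar> \<le> C"
  shows "ennreal \<bar>mean k f x - c\<bar> \<le> (\<integral>\<^sup>+v. ennreal \<bar>f v - c\<bar> \<partial>local_unif k x)"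
proof -
  interpret U: prob_space "local_unif k x" by (rule prob_space_local_unif)
  have "f \<in> borel_measurable (local_unif k x)"
    using measurable_continuous[OF f] by simp
  then have int: "integrable (local_unif k x) f"
    using bd by (intro U.integrable_const_bound[of _ C]) auto
  then have "mean k f x - c = (\<integral>v. f v - c \<partial>local_unif k x)"
    using U.prob_space by (simp add: mean_def)
  then show ?thesis
    using integral_norm_bound_ennreal[of "local_unif k x" "\<lambda>v. f v - c"] int by simp
qed

text \<open>The growth condition at \<open>y = level (Suc k)\<close>, where \<open>1 / \<phi> y\<close> is at most the mass of the ball.\<close>

lemma increment_le:
  assumes "dist u v \<le> r"
  shows "\<bar>f u - f v\<bar> \<le> r * level (Suc k) *
    (a + b * measure m (cball x (radius (Suc k) x)) * \<phi> (\<bar>f u - f v\<bar> / dist u v))"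
proof -
  define q where "q = \<bar>f u - f v\<bar> / dist u v"
  define p where "p = measure m (cball x (radius (Suc k) x))"
  define y where "y = level (Suc k)"
  have y: "0 < y" "1 \<le> \<phi> y" "1 \<le> \<phi> y * p"
    using level_pos phi_level_ge_1 radius_attained by (auto simp: y_def p_def)
  have q: "0 \<le> q" by (simp add: q_def)
  \<comment> \<open>The growth condition is used at q / y, so that \<phi> is evaluated at q
    itself.\<close>
  have "q / y \<le> a + b * (\<phi> (q / y * y) / \<phi> y)"
    using q y level_ge by (intro G_class_growth[OF G]) (auto simp: y_def)
  also have "\<dots> = a + b * (\<phi> q * (1 / \<phi> y))" using y by simp
  also have "\<dots> \<le> a + b * (\<phi> q * p)"
    using y b_nonneg G_class_nonneg[OF G q]
    by (intro add_left_mono mult_left_mono) (auto simp: field_simps)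
  finally have "q \<le> y * (a + b * p * \<phi> q)" using y by (simp add: field_simps)
  moreover have "\<bar>f u - f v\<bar> \<le> r * q"
  proof (cases "u = v")
    case False
    then have "\<bar>f u - f v\<bar> = dist u v * q" by (simp add: q_def)
    also have "\<dots> \<le> r * q" using assms q by (intro mult_right_mono)
    finally show ?thesis .
  qed (simp add: q_def)
  moreover have "0 \<le> r" using assms zero_le_dist[of u v] by linarith
  ultimately have "\<bar>f u - f v\<bar> \<le> r * (y * (a + b * p * \<phi> q))"
    by (meson mult_left_mono order_trans)
  then show ?thesis by (simp add: q_def p_def y_def mult.assoc)
qed

text \<open>This is \<open>increment_le\<close> averaged over v in the ball about u. The point x
  stays free of u: later it is the centre of the ball over which u is averaged, and the mass of that
  ball cancels.\<close>

lemma mean_increment_le: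
  assumes f: "continuous_on UNIV f" and bd: "\<And>x. \<bar>f x\<bar> \<le> C"
  shows "ennreal \<bar>mean k f u - f u\<bar> \<le> ennreal (a * (level (Suc k) * radius k u)) +
    ennreal (b * measure m (cball x (radius (Suc k) x))) *
      (ennreal (level (Suc k) * radius k u) * (\<integral>\<^sup>+v. quot f (u, v) \<partial>local_unif k u))"
proof -
  interpret U: prob_space "local_unif k u" by (rule prob_space_local_unif)
  define w where "w = level (Suc k) * radius k u"
  define p where "p = measure m (cball x (radius (Suc k) x))"
  have w: "0 \<le> w" using level_pos radius_nonneg by (simp add: w_def less_imp_le)
  have [measurable]: "(\<lambda>v. quot f (u, v)) \<in> borel_measurable m"
    by (rule measurable_section[OF quot_measurable[OF f]])
  have "ennreal \<bar>mean k f u - f u\<bar> \<le> (\<integral>\<^sup>+v. ennreal \<bar>f v - f u\<bar> \<partial>local_unif k u)"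
    by (rule mean_deviation[OF f bd])
  also have "\<dots> \<le> (\<integral>\<^sup>+v. ennreal (a * w) + ennreal (b * p * w) * quot f (u, v) \<partial>local_unif k u)"
  proof (rule nn_integral_mono_AE, rule AE_local_unif)
    fix v assume "dist u v \<le> radius k u"
    then have "\<bar>f v - f u\<bar> \<le> a * w + b * p * w * \<phi> (\<bar>f u - f v\<bar> / dist u v)"
      using increment_le[of u v "radius k u" f k x]
      by (simp add: w_def p_def algebra_simps abs_minus_commute)
    then have "ennreal \<bar>f v - f u\<bar> \<le> ennreal (a * w + b * p * w * \<phi> (\<bar>f u - f v\<bar> / dist u v))"
      by (rule ennreal_leI)
    also have "\<dots> = ennreal (a * w) + ennreal (b * p * w) * quot f (u, v)"
      using w a_nonneg b_nonneg G_class_nonneg[OF G, of "\<bar>f u - f v\<bar> / dist u v"]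
      by (simp add: quot_def ennreal_mult p_def)
    finally show "ennreal \<bar>f v - f u\<bar> \<le> ennreal (a * w) + ennreal (b * p * w) * quot f (u, v)" .
  qed
  also have "\<dots> = ennreal (a * w) + ennreal (b * p * w) * (\<integral>\<^sup>+v. quot f (u, v) \<partial>local_unif k u)"
    by (subst nn_integral_add) (auto simp: nn_integral_cmult U.emeasure_space_1[simplified])
  also have "ennreal (b * p * w) = ennreal (b * p) * ennreal w"
    using w b_nonneg by (intro ennreal_mult) (auto simp: p_def)
  finally show ?thesis by (simp add: w_def p_def mult.assoc)
qed

text \<open>A Lipschitz constant of \<open>chain_bound k\<close>. The recursion adds the
  contributions of its last summand, radii being 1-Lipschitz: \<open>level (Suc k)\<close> from the
  first term and \<open>level (Suc k) + lip k\<close> from the second.\<close>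

primrec lip :: "nat \<Rightarrow> real" where
  "lip 0 = 0"
| "lip (Suc k) = 2 * lip k + 2 * level (Suc k)"

text \<open>The coefficient of a after k steps. Step j bounds quantities at points u within
  \<open>radius (Suc j) x\<close> of x; the second term is the cost of replacing u by x, both in
  \<open>radius j\<close> and in the bound accumulated so far.\<close>

definition chain_bound :: "nat \<Rightarrow> 'a \<Rightarrow> real" where
  "chain_bound k x = (\<Sum>j<k. level (Suc j) * radius j x + (level (Suc j) + lip j) * radius (Suc j) x)"

lemma lip_nonneg: "0 \<le> lip k"
  using level_pos by (induction k) (auto simp: less_imp_le)

lemma chain_bound_nonneg: "0 \<le> chain_bound k x"
  unfolding chain_bound_def using level_pos radius_nonneg lip_nonneg
  by (intro sum_nonneg add_nonneg_nonneg mult_nonneg_nonneg) (auto simp: less_imp_le)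

lemma chain_bound_lipschitz: "chain_bound k u \<le> chain_bound k x + lip k * dist u x"
proof (induction k)
  case (Suc k)
  have "level (Suc k) * radius k u \<le> level (Suc k) * (radius k x + dist u x)"
    using level_pos radius_lipschitz by (intro mult_left_mono) (auto simp: less_imp_le)
  moreover have "(level (Suc k) + lip k) * radius (Suc k) u
      \<le> (level (Suc k) + lip k) * (radius (Suc k) x + dist u x)"
    using level_pos radius_lipschitz lip_nonneg by (intro mult_left_mono) (auto simp: less_imp_le)
  ultimately show ?case using Suc by (simp add: chain_bound_def algebra_simps)
qed (simp add: chain_bound_def)

text \<open>Induction on k. Over the ball of step k + 1 about x, the deviation of f(u) from the
  expectation splits at \<open>mean k f u\<close>: \<open>mean_increment_le\<close> bounds one part,
  the induction hypothesis at u the other.\<close>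

lemma mean_chain:
  assumes f: "continuous_on UNIV f" and bd: "\<And>x. \<bar>f x\<bar> \<le> C"
  shows "ennreal \<bar>mean k f x - expectation f\<bar> \<le>
    ennreal (a * chain_bound k x) + ennreal b * (\<Sum>j<k. energy j f)"
proof (induction k arbitrary: x)
  case 0
  then show ?case by (simp add: mean_def local_unif_0)
next
  case (Suc k)
  interpret U: prob_space "local_unif (Suc k) x" by (rule prob_space_local_unif)
  let ?B = "cball x (radius (Suc k) x)"
  define c where "c = expectation f"
  define p where "p = measure m ?B"
  define h where "h u = ennreal (level (Suc k) * radius k u) * (\<integral>\<^sup>+v. quot f (u, v) \<partial>local_unif k u)" for u
  define Q where "Q = (\<Sum>j<k. energy j f)"
  have p: "0 < p" unfolding p_def by (rule measure_radius_pos)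
  have energy: "energy k f = (\<integral>\<^sup>+u. h u \<partial>m)" by (simp add: energy_def h_def)
  have [measurable]: "h \<in> borel_measurable m"
    unfolding h_def using local_integral_measurable[OF quot_measurable[OF f]] by measurable
  have "ennreal \<bar>mean (Suc k) f x - c\<bar> \<le> (\<integral>\<^sup>+u. ennreal \<bar>f u - c\<bar> \<partial>local_unif (Suc k) x)"
    by (rule mean_deviation[OF f bd])
  also have "\<dots> \<le> (\<integral>\<^sup>+u. (ennreal (a * chain_bound (Suc k) x) + ennreal b * Q) + ennreal (b * p) * h u
      \<partial>local_unif (Suc k) x)"
  proof (rule nn_integral_mono_AE, rule AE_local_unif)
    fix u assume u: "dist x u \<le> radius (Suc k) x"
    have "ennreal \<bar>f u - c\<bar> \<le> ennreal (\<bar>mean k f u - f u\<bar> + \<bar>mean k f u - c\<bar>)"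
      by (intro ennreal_leI) simp
    also have "\<dots> = ennreal \<bar>mean k f u - f u\<bar> + ennreal \<bar>mean k f u - c\<bar>" by simp
    also have "\<dots> \<le> (ennreal (a * (level (Suc k) * radius k u)) + ennreal (b * p) * h u) +
        (ennreal (a * chain_bound k u) + ennreal b * Q)"
      using mean_increment_le[OF f bd, of k u x] Suc.IH[of u]
      by (intro add_mono) (auto simp: h_def p_def c_def Q_def)
    also have "\<dots> = ennreal (a * (level (Suc k) * radius k u) + a * chain_bound k u) + ennreal b * Q
        + ennreal (b * p) * h u"
      using a_nonneg level_pos radius_nonneg chain_bound_nonneg
      by (subst ennreal_plus) (auto simp: less_imp_le ac_simps)
    \<comment> \<open>Back from u to the centre x, by the Lipschitz bounds for the radius and for
      \<open>chain_bound\<close>.\<close>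
    also have "a * (level (Suc k) * radius k u) + a * chain_bound k u \<le> a * chain_bound (Suc k) x"
    proof -
      have "radius k u \<le> radius k x + radius (Suc k) x"
        using radius_lipschitz[of k u x] u by (simp add: dist_commute)
      then have "level (Suc k) * radius k u \<le> level (Suc k) * (radius k x + radius (Suc k) x)"
        using level_pos by (intro mult_left_mono) (auto simp: less_imp_le)
      moreover have "lip k * dist u x \<le> lip k * radius (Suc k) x"
        using u lip_nonneg by (intro mult_left_mono) (auto simp: dist_commute)
      ultimately have "level (Suc k) * radius k u + chain_bound k u \<le> chain_bound (Suc k) x"
        using chain_bound_lipschitz[of k u x] by (simp add: chain_bound_def algebra_simps)
      then show ?thesis using a_nonneg by (simp add: mult_left_mono flip: distrib_left)
    qed
    finally show "ennreal \<bar>f u - c\<bar> \<le>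
        (ennreal (a * chain_bound (Suc k) x) + ennreal b * Q) + ennreal (b * p) * h u"
      by (simp add: add_right_mono ennreal_leI)
  qed
  also have "\<dots> = (ennreal (a * chain_bound (Suc k) x) + ennreal b * Q)
      + ennreal (b * p) * (\<integral>\<^sup>+u. h u \<partial>local_unif (Suc k) x)"
    by (subst nn_integral_add) (auto simp: nn_integral_cmult U.emeasure_space_1[simplified])
  \<comment> \<open>The factor p cancels the normalisation of the mean. Dropping the restriction to
    the ball then leaves a bound independent of x.\<close>
  also have "ennreal (b * p) * (\<integral>\<^sup>+u. h u \<partial>local_unif (Suc k) x) \<le> ennreal b * energy k f"
  proof -
    have "(\<integral>\<^sup>+u. h u \<partial>local_unif (Suc k) x) = (\<integral>\<^sup>+u. h u * indicator ?B u \<partial>m) / ennreal p"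
      by (subst nn_integral_local_unif) (auto simp: p_def emeasure_eq_measure)
    also have "\<dots> \<le> energy k f / ennreal p"
      unfolding energy by (intro divide_right_mono_ennreal nn_integral_mono) (auto simp: indicator_def)
    finally have "ennreal (b * p) * (\<integral>\<^sup>+u. h u \<partial>local_unif (Suc k) x)
        \<le> ennreal (b * p) * (energy k f / ennreal p)"
      by (rule mult_left_mono) simp
    also have "\<dots> = ennreal b * (energy k f * ennreal p / ennreal p)"
      using p b_nonneg by (simp add: ennreal_mult ennreal_times_divide ac_simps)
    also have "\<dots> = ennreal b * energy k f"
      using p by (subst mult_divide_eq_ennreal) auto
    finally show ?thesis .
  qed
  finally show ?case
    by (simp add: Q_def c_def distrib_left ac_simps)
qed

text \<open>The limit of \<open>mean_chain\<close>: the radii at t become arbitrarily small, so by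
  continuity the means come arbitrarily close to f(t).\<close>

lemma deviation_le:
  assumes f: "continuous_on UNIV f" and bd: "\<And>x. \<bar>f x\<bar> \<le> C"
    and X: "\<And>n. ennreal (a * chain_bound n t) \<le> X"
  shows "ennreal \<bar>f t - expectation f\<bar> \<le> X + ennreal b * (\<Sum>j. energy j f)"
proof (rule ennreal_le_epsilon)
  fix e :: real assume "0 < e"
  then obtain d where d: "0 < d" "\<And>v. dist v t < d \<Longrightarrow> dist (f v) (f t) < e"
    using f unfolding continuous_on_iff by (metis UNIV_I)
  obtain n where n: "radius n t \<le> d / 2" using radius_arbitrarily_small[of "d/2" t] d by auto
  interpret U: prob_space "local_unif n t" by (rule prob_space_local_unif)
  have "ennreal \<bar>mean n f t - f t\<bar> \<le> (\<integral>\<^sup>+v. ennreal \<bar>f v - f t\<bar> \<partial>local_unif n t)"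
    by (rule mean_deviation[OF f bd])
  also have "\<dots> \<le> (\<integral>\<^sup>+v. ennreal e \<partial>local_unif n t)"
  proof (rule nn_integral_mono_AE, rule AE_local_unif)
    fix v assume "dist t v \<le> radius n t"
    then have "dist (f v) (f t) < e" using d n by (intro d) (auto simp: dist_commute)
    then show "ennreal \<bar>f v - f t\<bar> \<le> ennreal e" by (intro ennreal_leI) (simp add: dist_real_def)
  qed
  also have "\<dots> = ennreal e" by (simp add: U.emeasure_space_1[simplified])
  finally have 1: "ennreal \<bar>mean n f t - f t\<bar> \<le> ennreal e" .
  have "ennreal \<bar>f t - expectation f\<bar> \<le> ennreal (\<bar>mean n f t - expectation f\<bar> + \<bar>mean n f t - f t\<bar>)"
    by (intro ennreal_leI) simp
  also have "\<dots> = ennreal \<bar>mean n f t - expectation f\<bar> + ennreal \<bar>mean n f t - f t\<bar>" by simp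
  also have "\<dots> \<le> (X + ennreal b * (\<Sum>j. energy j f)) + ennreal e"
  proof (intro add_mono 1)
    have "(\<Sum>j<n. energy j f) \<le> (\<Sum>j. energy j f)" by (intro sum_le_suminf) auto
    then show "ennreal \<bar>mean n f t - expectation f\<bar> \<le> X + ennreal b * (\<Sum>j. energy j f)"
      by (intro order_trans[OF mean_chain[OF f bd]] add_mono X mult_left_mono) auto
  qed
  finally show "ennreal \<bar>f t - expectation f\<bar> \<le> X + ennreal b * (\<Sum>j. energy j f) + ennreal e" .
qed

text \<open>\<open>lip\<close> doubles at each step while the levels grow by the factor R, so for R
  > 2 it stays within a constant multiple of them. The factor R - 2 is kept on the left to avoid a
  division.\<close>

lemma lip_le: "(R - 2) * lip k \<le> 2 * R * level k"
proof (induction k)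
  case (Suc k)
  have "(R - 2) * lip (Suc k) = 2 * ((R - 2) * lip k) + 2 * (R - 2) * level (Suc k)"
    by (simp add: algebra_simps)
  also have "\<dots> \<le> 2 * (2 * R * level k) + 2 * (R - 2) * level (Suc k)"
    using Suc by (intro add_right_mono mult_left_mono) auto
  also have "\<dots> = 2 * R * level (Suc k)" by (simp add: level_Suc algebra_simps)
  finally show ?case .
qed (use R_ge level_pos[of 0] in simp)

text \<open>The first terms of \<open>chain_bound\<close> add up to at most \<Sigma>, the second
  ones to at most \<Sigma>/(R - 2); \<open>sum_radius_le_sigma\<close> then bounds \<Sigma>.\<close>

lemma chain_bound_le_sigma:
  assumes "2 < R"
  shows "ennreal (chain_bound n x) \<le> A_const R * sigma_fun \<phi> m x"
proof -
  \<comment> \<open>One summand more than in \<open>chain_bound n\<close>, so that the sum with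
    shifted index is covered as well.\<close>
  define \<Sigma> where "\<Sigma> = (\<Sum>k<Suc n. level (Suc k) * radius k x)"
  have increment: "(level (Suc j) + lip j) * radius (Suc j) x \<le> 1 / (R - 2) * (level (Suc (Suc j)) * radius (Suc j) x)" for j
  proof -
    \<comment> \<open>By \<open>lip_le\<close> the part with \<open>lip j\<close> is at most twice
      \<open>level (Suc j)\<close>, and (R - 2) + 2 = R.\<close>
    have "(R - 2) * (level (Suc j) + lip j) \<le> level (Suc (Suc j))"
      using lip_le[of j] by (simp add: level_Suc algebra_simps)
    then have "level (Suc j) + lip j \<le> 1 / (R - 2) * level (Suc (Suc j))"
      using assms by (simp add: field_simps)
    from mult_right_mono[OF this radius_nonneg] show ?thesis by (simp add: mult.assoc)
  qed
  have nn: "0 \<le> level (Suc j) * radius j x" for j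
    using level_pos radius_nonneg by (simp add: less_imp_le)
  have "chain_bound n x = (\<Sum>j<n. level (Suc j) * radius j x) + (\<Sum>j<n. (level (Suc j) + lip j) * radius (Suc j) x)"
    by (simp add: chain_bound_def sum.distrib)
  also have "\<dots> \<le> \<Sigma> + (\<Sum>j<n. 1 / (R - 2) * (level (Suc (Suc j)) * radius (Suc j) x))"
    using nn[of n] by (intro add_mono sum_mono increment) (simp add: \<Sigma>_def)
  also have "\<dots> = \<Sigma> + 1 / (R - 2) * (\<Sum>j<n. level (Suc (Suc j)) * radius (Suc j) x)"
    by (simp add: sum_distrib_left)
  also have "\<dots> \<le> \<Sigma> + 1 / (R - 2) * \<Sigma>"
    using assms nn[of 0]
    by (intro add_left_mono mult_left_mono) (auto simp: \<Sigma>_def sum.lessThan_Suc_shift simp del: sum.lessThan_Suc)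
  also have "\<dots> = R\<^sup>2 / (R - 2) * ((R - 1) / R\<^sup>2 * \<Sigma>)"
    using assms by (simp add: field_simps)
  \<comment> \<open>The factor R/(R - 1) \<ge> 1 enlarges the constant to A.\<close>
  also have "\<dots> \<le> R ^ 3 / ((R - 1) * (R - 2)) * ((R - 1) / R\<^sup>2 * \<Sigma>)"
  proof (rule mult_right_mono)
    show "R\<^sup>2 / (R - 2) \<le> R ^ 3 / ((R - 1) * (R - 2))"
      using assms mult_left_mono[of 1 "R / (R - 1)" "R\<^sup>2 / (R - 2)"]
      by (simp add: power2_eq_square power3_eq_cube mult.commute)
    show "0 \<le> (R - 1) / R\<^sup>2 * \<Sigma>"
      using assms unfolding \<Sigma>_def by (intro mult_nonneg_nonneg[OF _ sum_nonneg[OF nn]]) simp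
  qed
  finally have "ennreal (chain_bound n x) \<le> ennreal (R ^ 3 / ((R - 1) * (R - 2)) * ((R - 1) / R\<^sup>2 * \<Sigma>))"
    by (rule ennreal_leI)
  also have "\<dots> = A_const R * ennreal ((R - 1) / R\<^sup>2 * \<Sigma>)"
    using assms by (subst ennreal_mult') (auto simp: A_const_def)
  also have "\<dots> \<le> A_const R * sigma_fun \<phi> m x"
    unfolding \<Sigma>_def by (intro mult_left_mono sum_radius_le_sigma) simp
  finally show ?thesis .
qed

section \<open>The measure on the product\<close>

text \<open>Density against \<open>m \<Otimes>\<^sub>M m\<close> of the measure that weights u by
  level times radius and then draws v from the normalised restriction of m to the ball about
  u.\<close>

definition kernel :: "nat \<Rightarrow> 'a \<times> 'a \<Rightarrow> ennreal" where
  "kernel k = (\<lambda>(u, v). ennreal (level (Suc k) * radius k u) *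
     (indicator (cball u (radius k u)) v / emeasure m (cball u (radius k u))))"

lemma kernel_measurable [measurable]: "kernel k \<in> borel_measurable (m \<Otimes>\<^sub>M m)"
  unfolding kernel_def by measurable

lemma nn_integral_kernel:
  assumes g: "g \<in> borel_measurable (m \<Otimes>\<^sub>M m)"
  shows "(\<integral>\<^sup>+z. kernel k z * g z \<partial>(m \<Otimes>\<^sub>M m)) =
    (\<integral>\<^sup>+u. ennreal (level (Suc k) * radius k u) * (\<integral>\<^sup>+v. g (u, v) \<partial>local_unif k u) \<partial>m)"
proof -
  have "(\<integral>\<^sup>+z. kernel k z * g z \<partial>(m \<Otimes>\<^sub>M m)) = (\<integral>\<^sup>+u. \<integral>\<^sup>+v. kernel k (u, v) * g (u, v) \<partial>m \<partial>m)"
    using g by (intro nn_integral_fst[symmetric]) measurable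
  also have "\<dots> = (\<integral>\<^sup>+u. ennreal (level (Suc k) * radius k u) * (\<integral>\<^sup>+v. g (u, v) \<partial>local_unif k u) \<partial>m)"
  proof (rule nn_integral_cong)
    fix u
    have [measurable]: "(\<lambda>v. g (u, v)) \<in> borel_measurable m" by (rule measurable_section[OF g])
    have "(\<integral>\<^sup>+v. kernel k (u, v) * g (u, v) \<partial>m) = (\<integral>\<^sup>+v. ennreal (level (Suc k) * radius k u) *
        ((g (u, v) * indicator (cball u (radius k u)) v) / emeasure m (cball u (radius k u))) \<partial>m)"
      by (intro nn_integral_cong) (simp add: kernel_def divide_ennreal_def ac_simps)
    also have "\<dots> = ennreal (level (Suc k) * radius k u) * (\<integral>\<^sup>+v. g (u, v) \<partial>local_unif k u)"
      by (subst nn_integral_cmult) (auto simp: nn_integral_divide nn_integral_local_unif)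
    finally show "(\<integral>\<^sup>+v. kernel k (u, v) * g (u, v) \<partial>m) =
        ennreal (level (Suc k) * radius k u) * (\<integral>\<^sup>+v. g (u, v) \<partial>local_unif k u)" .
  qed
  finally show ?thesis .
qed

definition total_kernel :: "'a \<times> 'a \<Rightarrow> ennreal" where
  "total_kernel z = (\<Sum>k. kernel k z)"

lemma total_kernel_measurable [measurable]: "total_kernel \<in> borel_measurable (m \<Otimes>\<^sub>M m)"
  unfolding total_kernel_def by measurable

lemma nn_integral_total_kernel:
  assumes [measurable]: "g \<in> borel_measurable (m \<Otimes>\<^sub>M m)"
  shows "(\<integral>\<^sup>+z. total_kernel z * g z \<partial>(m \<Otimes>\<^sub>M m)) =
    (\<Sum>k. \<integral>\<^sup>+u. ennreal (level (Suc k) * radius k u) * (\<integral>\<^sup>+v. g (u, v) \<partial>local_unif k u) \<partial>m)"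
proof -
  have "(\<integral>\<^sup>+z. total_kernel z * g z \<partial>(m \<Otimes>\<^sub>M m)) = (\<integral>\<^sup>+z. (\<Sum>k. kernel k z * g z) \<partial>(m \<Otimes>\<^sub>M m))"
    by (simp add: total_kernel_def)
  also have "\<dots> = (\<Sum>k. \<integral>\<^sup>+z. kernel k z * g z \<partial>(m \<Otimes>\<^sub>M m))"
    by (intro nn_integral_suminf) measurable
  finally show ?thesis by (simp add: nn_integral_kernel)
qed

lemma total_kernel_energy:
  assumes "continuous_on UNIV f"
  shows "(\<integral>\<^sup>+z. total_kernel z * quot f z \<partial>(m \<Otimes>\<^sub>M m)) = (\<Sum>k. energy k f)"
  by (simp add: nn_integral_total_kernel[OF quot_measurable[OF assms]] energy_def)

text \<open>Integrating out v leaves the sum of level times radius at u, because the local measures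
  are probabilities. By \<open>sum_radius_le_sigma\<close> this is at most B \<sigma>(u).\<close>

lemma total_kernel_mass: "(\<integral>\<^sup>+z. total_kernel z \<partial>(m \<Otimes>\<^sub>M m)) \<le> B_const R * S_bar \<phi> m"
proof -
  have U: "emeasure (local_unif k u) UNIV = 1" for k u
    using prob_space.emeasure_space_1[OF prob_space_local_unif[of u k]] by (simp add: space_m)
  have RR: "0 < R\<^sup>2 / (R - 1)" "0 < (R - 1) / R\<^sup>2" using R_ge by auto
  have "R\<^sup>2 / (R - 1) * ((R - 1) / R\<^sup>2) = 1" using R_ge by simp
  then have BR: "B_const R * ennreal ((R - 1) / R\<^sup>2) = 1"
    using RR by (simp add: B_const_def del: times_divide_eq_left times_divide_eq_right flip: ennreal_mult)
  have nn: "0 \<le> level (Suc j) * radius j x" for j x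
    using level_pos radius_nonneg by (simp add: less_imp_le)
  have "(\<integral>\<^sup>+z. total_kernel z \<partial>(m \<Otimes>\<^sub>M m)) = (\<integral>\<^sup>+z. total_kernel z * 1 \<partial>(m \<Otimes>\<^sub>M m))" by simp
  also have "\<dots> = (\<Sum>k. \<integral>\<^sup>+u. ennreal (level (Suc k) * radius k u) \<partial>m)"
    by (subst nn_integral_total_kernel) (auto simp: U space_m)
  also have "\<dots> = (\<integral>\<^sup>+u. (\<Sum>k. ennreal (level (Suc k) * radius k u)) \<partial>m)"
    by (intro nn_integral_suminf[symmetric]) measurable
  \<comment> \<open>The inserted factor is 1: B is the reciprocal of the constant in
    \<open>sum_radius_le_sigma\<close>.\<close>
  also have "\<dots> = (\<integral>\<^sup>+u. B_const R * (ennreal ((R - 1) / R\<^sup>2) * (\<Sum>k. ennreal (level (Suc k) * radius k u))) \<partial>m)"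
    by (simp add: BR flip: mult.assoc)
  also have "\<dots> = B_const R * (\<integral>\<^sup>+u. ennreal ((R - 1) / R\<^sup>2) * (\<Sum>k. ennreal (level (Suc k) * radius k u)) \<partial>m)"
    by (intro nn_integral_cmult) measurable
  also have "\<dots> \<le> B_const R * S_bar \<phi> m"
    unfolding S_bar_def
  proof (intro mult_left_mono nn_integral_mono)
    fix u
    have "(\<Sum>k. ennreal ((R - 1) / R\<^sup>2) * ennreal (level (Suc k) * radius k u)) \<le> sigma_fun \<phi> m u"
    proof (rule suminf_le_const)
      fix n
      have "(\<Sum>k<n. ennreal ((R - 1) / R\<^sup>2) * ennreal (level (Suc k) * radius k u)) =
          ennreal ((R - 1) / R\<^sup>2 * (\<Sum>k<n. level (Suc k) * radius k u))"
        using RR nn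
        by (subst ennreal_mult) (auto simp: sum_ennreal sum_nonneg less_imp_le simp flip: sum_distrib_left)
      then show "(\<Sum>k<n. ennreal ((R - 1) / R\<^sup>2) * ennreal (level (Suc k) * radius k u)) \<le> sigma_fun \<phi> m u"
        using sum_radius_le_sigma[of u n] by simp
    qed simp
    then show "ennreal ((R - 1) / R\<^sup>2) * (\<Sum>k. ennreal (level (Suc k) * radius k u)) \<le> sigma_fun \<phi> m u"
      by simp
  qed simp
  finally show ?thesis .
qed

text \<open>\<nu> is the measure with density \<open>total_kernel\<close>, divided by its total mass
  M, which is at most B times \<open>S_bar\<close>. If M = 0, all energies vanish and the product
  measure serves.\<close>

lemma chaining_measure:
  assumes fin: "S_bar \<phi> m \<noteq> \<infinity>"
  shows "\<exists>\<nu>. prob_space \<nu> \<and> sets \<nu> = sets borel \<and>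
    (\<forall>f. continuous_on UNIV f \<longrightarrow> (\<Sum>k. energy k f) \<le> B_const R * S_bar \<phi> m * (\<integral>\<^sup>+z. quot f z \<partial>\<nu>))"
proof -
  interpret P: pair_prob_space m m ..
  define M where "M = (\<integral>\<^sup>+z. total_kernel z \<partial>(m \<Otimes>\<^sub>M m))"
  have M: "M \<le> B_const R * S_bar \<phi> m"
    unfolding M_def by (rule total_kernel_mass)
  also have "\<dots> < \<infinity>"
    using fin by (auto simp: B_const_def ennreal_mult_less_top less_top)
  finally have M_fin: "M \<noteq> \<infinity>" by simp
  show ?thesis
  proof (cases "M = 0")
    case True
    then have "AE z in m \<Otimes>\<^sub>M m. total_kernel z = 0"
      unfolding M_def by (subst (asm) nn_integral_0_iff_AE) auto
    then have "(\<integral>\<^sup>+z. total_kernel z * quot f z \<partial>(m \<Otimes>\<^sub>M m)) = (\<integral>\<^sup>+z. 0 \<partial>(m \<Otimes>\<^sub>M m))" for f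
      by (intro nn_integral_cong_AE) auto
    then have "(\<Sum>k. energy k f) = 0" if "continuous_on UNIV f" for f
      using total_kernel_energy[OF that] by simp
    then show ?thesis
      using P.prob_space_axioms sets_pair by (intro exI[of _ "m \<Otimes>\<^sub>M m"]) auto
  next
    case False
    define \<nu> where "\<nu> = density (m \<Otimes>\<^sub>M m) (\<lambda>z. total_kernel z / M)"
    have "emeasure \<nu> (space \<nu>) = 1"
      using False M_fin unfolding \<nu>_def
      by (simp add: emeasure_density nn_integral_divide M_def[symmetric] ennreal_divide_self less_top
          cong: nn_integral_cong_simp)
    then have "prob_space \<nu>" by (rule prob_spaceI)
    moreover have "sets \<nu> = sets borel" by (simp add: \<nu>_def sets_pair)
    moreover have "(\<Sum>k. energy k f) \<le> B_const R * S_bar \<phi> m * (\<integral>\<^sup>+z. quot f z \<partial>\<nu>)"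
      if f: "continuous_on UNIV f" for f
    proof -
      note [measurable] = quot_measurable[OF f]
      have "(\<integral>\<^sup>+z. quot f z \<partial>\<nu>) = (\<integral>\<^sup>+z. total_kernel z / M * quot f z \<partial>(m \<Otimes>\<^sub>M m))"
        unfolding \<nu>_def by (intro nn_integral_density) measurable
      also have "\<dots> = (\<integral>\<^sup>+z. (total_kernel z * quot f z) / M \<partial>(m \<Otimes>\<^sub>M m))"
        by (simp add: divide_ennreal_def ac_simps)
      also have "\<dots> = (\<Sum>k. energy k f) / M"
        by (subst nn_integral_divide) (auto simp: total_kernel_energy[OF f])
      finally have "M * (\<integral>\<^sup>+z. quot f z \<partial>\<nu>) = (\<Sum>k. energy k f) * M / M"
        by (simp add: ennreal_times_divide mult.commute)
      also have "\<dots> = (\<Sum>k. energy k f)"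
        using False M_fin by (intro mult_divide_eq_ennreal) auto
      finally show ?thesis using mult_right_mono[OF M, of "\<integral>\<^sup>+z. quot f z \<partial>\<nu>"] by simp
    qed
    ultimately show ?thesis by blast
  qed
qed

text \<open>Both values are compared with the expectation, whence the factors 2. If a = 0 the first
  term vanishes even for infinite A; if R > 2, \<open>chain_bound_le_sigma\<close> applies.\<close>

lemma oscillation_le:
  assumes f: "continuous_on UNIV f" and aR: "a = 0 \<or> 2 < R"
    and \<nu>: "\<And>g. continuous_on UNIV g \<Longrightarrow>
      (\<Sum>k. energy k g) \<le> B_const R * S_bar \<phi> m * (\<integral>\<^sup>+z. quot g z \<partial>\<nu>)"
  shows "ennreal \<bar>f s - f t\<bar> \<le> 2 * ennreal a * A_const R * S_sup \<phi> m +
    2 * ennreal b * B_const R * S_bar \<phi> m * (\<integral>\<^sup>+z. quot f z \<partial>\<nu>)"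
proof -
  \<comment> \<open>The chaining bound needs a bounded function, so \<open>f\<close> is truncated at a level that keeps \<open>f s\<close> and \<open>f t\<close>.\<close>
  define C where "C = max \<bar>f s\<bar> \<bar>f t\<bar>"
  define g where "g x = max (- C) (min C (f x))" for x
  have g: "continuous_on UNIV g" unfolding g_def by (intro continuous_intros f)
  have bd: "\<bar>g x\<bar> \<le> C" for x by (auto simp: g_def C_def max_def min_def)
  have st: "g s = f s" "g t = f t" by (auto simp: g_def C_def)
  define X where "X = ennreal a * (A_const R * S_sup \<phi> m)"
  define Y where "Y = B_const R * S_bar \<phi> m * (\<integral>\<^sup>+z. quot f z \<partial>\<nu>)"
  have X: "ennreal (a * chain_bound n x) \<le> X" for n x
  proof (cases "a = 0")
    case False
    then have "ennreal (chain_bound n x) \<le> A_const R * sigma_fun \<phi> m x"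
      using aR by (intro chain_bound_le_sigma) simp
    also have "\<dots> \<le> A_const R * S_sup \<phi> m"
      unfolding S_sup_def by (intro mult_left_mono SUP_upper) auto
    finally show ?thesis
      unfolding X_def using a_nonneg chain_bound_nonneg by (simp add: ennreal_mult mult_left_mono)
  qed simp
  \<comment> \<open>Truncation does not increase differences, and \<phi> is increasing.\<close>
  have "quot g z \<le> quot f z" for z
  proof -
    obtain u v where z: "z = (u, v)" by force
    have "\<bar>g u - g v\<bar> \<le> \<bar>f u - f v\<bar>" by (auto simp: g_def)
    then show ?thesis
      unfolding quot_def z by (auto intro!: ennreal_leI G_class_mono[OF G] divide_right_mono)
  qed
  then have "(\<Sum>k. energy k g) \<le> Y"
    unfolding Y_def by (intro order_trans[OF \<nu>[OF g]] mult_left_mono nn_integral_mono) auto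
  then have dev: "ennreal \<bar>g x - expectation g\<bar> \<le> X + ennreal b * Y" for x
    by (intro order_trans[OF deviation_le[OF g bd X]] add_left_mono mult_left_mono) auto
  have "ennreal \<bar>f s - f t\<bar> \<le> ennreal (\<bar>g s - expectation g\<bar> + \<bar>g t - expectation g\<bar>)"
    unfolding st[symmetric] by (intro ennreal_leI) simp
  also have "\<dots> = ennreal \<bar>g s - expectation g\<bar> + ennreal \<bar>g t - expectation g\<bar>" by simp
  also have "\<dots> \<le> (X + ennreal b * Y) + (X + ennreal b * Y)" by (intro add_mono dev)
  also have "\<dots> = 2 * ennreal a * A_const R * S_sup \<phi> m +
      2 * ennreal b * B_const R * S_bar \<phi> m * (\<integral>\<^sup>+z. quot f z \<partial>\<nu>)"
    by (simp add: X_def Y_def mult_2[symmetric] distrib_left mult.assoc)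
  finally show ?thesis .
qed

end

section \<open>Lower bounds on the majorizing integrals, and the degenerate cases\<close>

context full_support_prob
begin

text \<open>Balls have mass at most 1, so the integrand is at least the inverse of \<phi> at 1 up to
  the diameter. Hence a finite \<open>S_bar\<close> forces a bounded space, and \<open>S_sup\<close>
  = 0 forces a single point.\<close>

lemma sigma_ge: "ennreal (inv_nonneg \<phi> 1 * dist (s :: 'a) t) \<le> sigma_fun \<phi> m x"
proof -
  have "ennreal (inv_nonneg \<phi> 1 * dist s t)
      = (\<integral>\<^sup>+e. ennreal (inv_nonneg \<phi> 1) * indicator {0<..dist s t} e \<partial>lborel)"
    using G_class_inv_one_pos[OF G] by (simp add: nn_integral_cmult_indicator ennreal_mult)
  also have "\<dots> \<le> sigma_fun \<phi> m x"
    unfolding sigma_fun_def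
  proof (rule nn_integral_mono)
    fix e :: real
    show "ennreal (inv_nonneg \<phi> 1) * indicator {0<..dist s t} e
      \<le> ennreal (inv_nonneg \<phi> (1 / measure m (cball x e))) *
        indicator {e. 0 < e \<and> ennreal e \<le> ediam (UNIV :: 'a set)} e"
    proof (cases "e \<in> {0<..dist s t}")
      case True
      then have "ennreal e \<le> ennreal (dist s t)" by (simp add: ennreal_leI)
      also have "\<dots> \<le> ediam (UNIV :: 'a set)"
        unfolding ediam_def by (intro SUP_upper2[of s] SUP_upper2[of t]) auto
      finally have "ennreal e \<le> ediam (UNIV :: 'a set)" .
      moreover have "inv_nonneg \<phi> 1 \<le> inv_nonneg \<phi> (1 / measure m (cball x e))"
      proof (rule ccontr)
        assume less: "\<not> ?thesis"
        have p: "0 < measure m (cball x e)" using measure_cball_pos True by auto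
        then have "\<phi> (inv_nonneg \<phi> (1 / measure m (cball x e))) < \<phi> (inv_nonneg \<phi> 1)"
          using less by (intro G_class_strict_mono[OF G] G_class_inv_nonneg[OF G]) auto
        then show False using p prob_le_1[of "cball x e"] by (simp add: G_class_inv[OF G])
      qed
      ultimately show ?thesis using True by (simp add: ennreal_leI)
    qed simp
  qed
  finally show ?thesis .
qed

lemma S_sup_ge: "ennreal (inv_nonneg \<phi> 1 * dist (s :: 'a) t) \<le> S_sup \<phi> m"
  unfolding S_sup_def by (intro SUP_upper2[of s] sigma_ge) simp

lemma S_bar_ge: "ennreal (inv_nonneg \<phi> 1 * dist (s :: 'a) t) \<le> S_bar \<phi> m"
proof -
  have "(\<integral>\<^sup>+u. ennreal (inv_nonneg \<phi> 1 * dist s t) \<partial>m) \<le> S_bar \<phi> m"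
    unfolding S_bar_def by (intro nn_integral_mono sigma_ge)
  then show ?thesis by (simp add: emeasure_space_1)
qed

text \<open>If f differs at s and t, the integrand is positive on a product of neighbourhoods of s
  and t, which has positive measure by full support.\<close>

lemma constant_if_quot_null:
  assumes f: "continuous_on UNIV f" and null: "(\<integral>\<^sup>+z. quot f z \<partial>(m \<Otimes>\<^sub>M m)) = 0"
  shows "f s = f t"
proof (rule ccontr)
  assume neq: "f s \<noteq> f t"
  define d where "d = \<bar>f s - f t\<bar> / 2"
  define U where "U = f -` ball (f s) d"
  define V where "V = f -` ball (f t) d"
  have d: "d > 0" using neq by (simp add: d_def)
  have "open U" "open V"
    unfolding U_def V_def using f by (auto simp: open_vimage)
  have "s \<in> U" "t \<in> V" using d by (auto simp: U_def V_def)
  have "AE z in m \<Otimes>\<^sub>M m. quot f z = 0"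
    using null quot_measurable[OF f] by (simp add: nn_integral_0_iff_AE)
  moreover have "quot f z \<noteq> 0" if z: "z \<in> U \<times> V" for z
  proof -
    obtain u v where uv: "z = (u, v)" "u \<in> U" "v \<in> V" using z by auto
    have "f u \<noteq> f v" using uv by (auto simp: U_def V_def d_def dist_real_def abs_if split: if_splits)
    then have "0 < \<phi> (\<bar>f u - f v\<bar> / dist u v)"
      using G_class_strict_mono[OF G, of 0] G_class_zero[OF G]
      by (metis dist_nz less_irrefl order_refl zero_less_abs_iff zero_less_divide_iff right_minus_eq)
    then show ?thesis by (simp add: quot_def uv)
  qed
  ultimately have "AE z in m \<Otimes>\<^sub>M m. z \<notin> U \<times> V" by (auto elim!: eventually_mono)
  then have "emeasure (m \<Otimes>\<^sub>M m) (U \<times> V) = 0"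
    using \<open>open U\<close> \<open>open V\<close> by (subst (asm) AE_iff_measurable[of "U \<times> V"])
      (auto simp: space_pair_measure space_m sets_m)
  then have "emeasure m U * emeasure m V = 0"
    using \<open>open U\<close> \<open>open V\<close> by (simp add: emeasure_pair_measure_Times sets_m)
  then show False
    using emeasure_open_pos[OF support \<open>open U\<close> \<open>s \<in> U\<close>] emeasure_open_pos[OF support \<open>open V\<close> \<open>t \<in> V\<close>]
    by auto
qed

end

theorem corollary1p1:
  fixes m :: "'a::metric_space measure"
    and a b R :: real
    and \<phi> :: "real \<Rightarrow> real"
  assumes "prob_space m"
    and "sets m = sets borel"
    and "measure_support m = UNIV"
    and "a \<ge> 0" and "b \<ge> 0"
    and "\<phi> \<in> G_class a b"
    and "R \<ge> 2"
  shows "\<exists>\<nu> :: ('a \<times> 'a) measure. prob_space \<nu> \<and> sets \<nu> = sets borel \<and>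
    (\<forall>f :: 'a \<Rightarrow> real. continuous_on UNIV f \<longrightarrow>
      (SUP s. SUP t. ennreal \<bar>f s - f t\<bar>) \<le>
        2 * ennreal a * A_const R * S_sup \<phi> m +
        2 * ennreal b * B_const R * S_bar \<phi> m *
          (\<integral>\<^sup>+(u, v). ennreal (\<phi> (\<bar>f u - f v\<bar> / dist u v)) \<partial>\<nu>))"
proof -
  interpret full_support_prob m a b R \<phi>
    using assms by (simp add: full_support_prob_def full_support_prob_axioms_def)
  have bB: "2 * ennreal b * B_const R \<noteq> 0"
    using G_class_b_pos[OF G b_nonneg] R_ge by (auto simp: B_const_def)
  show ?thesis
    unfolding quot_def[symmetric]
  proof (cases "S_bar \<phi> m = \<infinity>")
    case True
    interpret P: pair_prob_space m m ..
    show "\<exists>\<nu>. prob_space \<nu> \<and> sets \<nu> = sets borel \<and> (\<forall>f. continuous_on UNIV f \<longrightarrow>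
      (SUP s. SUP t. ennreal \<bar>f s - f t\<bar>) \<le> 2 * ennreal a * A_const R * S_sup \<phi> m +
        2 * ennreal b * B_const R * S_bar \<phi> m * (\<integral>\<^sup>+z. quot f z \<partial>\<nu>))"
    proof (intro exI[of _ "m \<Otimes>\<^sub>M m"] conjI allI impI SUP_least)
      fix f :: "'a \<Rightarrow> real" and s t :: 'a assume f: "continuous_on UNIV f"
      show "ennreal \<bar>f s - f t\<bar> \<le> 2 * ennreal a * A_const R * S_sup \<phi> m +
        2 * ennreal b * B_const R * S_bar \<phi> m * (\<integral>\<^sup>+z. quot f z \<partial>(m \<Otimes>\<^sub>M m))"
      \<comment> \<open>With 0 times infinity being 0, an infinite \<open>S_bar\<close> gives an
        infinite bound only if the integral is nonzero; if it is zero, f is constant.\<close>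
      proof (cases "(\<integral>\<^sup>+z. quot f z \<partial>(m \<Otimes>\<^sub>M m)) = 0")
        case True
        then show ?thesis using constant_if_quot_null[OF f, of s t] by simp
      next
        case False
        then show ?thesis using True bB by (simp add: ennreal_mult_top ennreal_top_mult)
      qed
    qed (use P.prob_space_axioms sets_pair in auto)
  next
    case False
    \<comment> \<open>\<open>S_bar_ge\<close> makes this a bound on all distances, which places the
      space in the bounded setting.\<close>
    define D where "D = enn2real (S_bar \<phi> m) / inv_nonneg \<phi> 1"
    have "dist x y \<le> D" for x y :: 'a
    proof -
      have "ennreal (inv_nonneg \<phi> 1 * dist x y) \<le> ennreal (enn2real (S_bar \<phi> m))"
        using S_bar_ge[of x y] False by (simp add: less_top)
      then show ?thesis
        using G_class_inv_one_pos[OF G] by (simp add: D_def field_simps)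
    qed
    then interpret majorizing_measure m a b R \<phi> D by unfold_locales
    obtain \<nu> where \<nu>: "prob_space \<nu>" "sets \<nu> = sets borel"
      "\<And>f. continuous_on UNIV f \<Longrightarrow> (\<Sum>k. energy k f) \<le> B_const R * S_bar \<phi> m * (\<integral>\<^sup>+z. quot f z \<partial>\<nu>)"
      using chaining_measure[OF False] by blast
    show "\<exists>\<nu>. prob_space \<nu> \<and> sets \<nu> = sets borel \<and> (\<forall>f. continuous_on UNIV f \<longrightarrow>
      (SUP s. SUP t. ennreal \<bar>f s - f t\<bar>) \<le> 2 * ennreal a * A_const R * S_sup \<phi> m +
        2 * ennreal b * B_const R * S_bar \<phi> m * (\<integral>\<^sup>+z. quot f z \<partial>\<nu>))"
    proof (intro exI[of _ \<nu>] conjI allI impI SUP_least \<nu>)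
      fix f :: "'a \<Rightarrow> real" and s t :: 'a assume f: "continuous_on UNIV f"
      show "ennreal \<bar>f s - f t\<bar> \<le> 2 * ennreal a * A_const R * S_sup \<phi> m +
        2 * ennreal b * B_const R * S_bar \<phi> m * (\<integral>\<^sup>+z. quot f z \<partial>\<nu>)"
      \<comment> \<open>The remaining case is a > 0 and R = 2, where A is infinite: the bound is
        infinite unless \<open>S_sup\<close> is 0, and then s = t.\<close>
      proof (cases "a = 0 \<or> 2 < R")
        case True
        then show ?thesis by (intro oscillation_le f \<nu>(3))
      next
        case False
        then have "0 < a" "R = 2" using a_nonneg R_ge by auto
        show ?thesis
        proof (cases "S_sup \<phi> m = 0")
          case True
          then have "ennreal (inv_nonneg \<phi> 1 * dist s t) \<le> 0" using S_sup_ge by metis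
          then have "s = t"
            using G_class_inv_one_pos[OF G]
            by (simp add: ennreal_eq_0_iff mult_le_0_iff)
          then show ?thesis by simp
        next
          case False
          then have "2 * ennreal a * A_const R * S_sup \<phi> m = \<infinity>"
            using \<open>0 < a\<close> \<open>R = 2\<close> by (simp add: A_const_def ennreal_mult_top ennreal_top_mult)
          then show ?thesis by simp
        qed
      qed
    qed
  qed
qed

end
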